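(* The set of all $(x,y,z)\in\mathbb{N}^3$ satisfying $3\cdot 3^x+3^y=z^2$ is $$\left\{(2n,\,2n,\,2\cdot 3^n) : n\in\mathbb{N}\right\}\cup\left\{(1+2n,\,3+2n,\,2\cdot 3^{n+1}) : n\in\mathbb{N}\right\}.$$
   Context: $\mathbb{N}=\{0,1,2,3,\ldots\}$ denotes the set of non-negative integers. *)

theory Defs
  imports Main
begin

end

(* Up to symmetry the equation reads 3^a + 3^b = z^2 with a <= b. Dividing z by 3 lowers both
   exponents by 2, so only a = 0 and a = 1 remain. The case a = 1 fails modulo 9. For a = 0 the
   power 3^b equals (z - 1)(z + 1), and 3 cannot divide both factors, so one of them is 1. *)

theory Submission imports Defs "HOL-Computational_Algebra.Primes" begin

lemma three_dvd_square_iff: "3 dvd z ^ 2 \<longleftrightarrow> 3 dvd z" for z :: nat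
  by (simp add: prime_dvd_power_iff)

lemma dvd_power_three_eq_one:
  fixes m :: nat
  assumes "m dvd 3 ^ b" "\<not> 3 dvd m"
  shows "m = 1"
proof -
  have "coprime 3 m" using assms(2) by (intro prime_imp_coprime) auto
  then have "coprime m (3 ^ b)" by (simp add: coprime_commute)
  with assms(1) show ?thesis by (metis coprime_absorb_left nat_dvd_1_iff_1)
qed

lemma one_plus_power_three_eq_square:
  fixes z :: nat
  assumes eq: "1 + 3 ^ b = z ^ 2"
  shows "b = 1 \<and> z = 2"
proof -
  \<comment> \<open>Writing \<open>z = Suc m\<close> turns z - 1 and z + 1 into \<open>m\<close> and
    \<open>m + 2\<close>, without truncated subtraction.\<close>
  have "z \<noteq> 0" using eq by (intro notI) simp
  then obtain m where z: "z = Suc m" by (cases z) auto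
  have fac: "m * (m + 2) = 3 ^ b"
    using eq by (simp add: z power2_eq_square algebra_simps)
  have "m dvd 3 ^ b" "m + 2 dvd 3 ^ b"
    unfolding fac[symmetric] by (rule dvd_triv_left, rule dvd_triv_right)
  \<comment> \<open>The factors differ by 2. The factor prime to 3 equals 1, and
    \<open>m + 2 = 1\<close> is impossible, so it is \<open>m\<close>.\<close>
  moreover have "\<not> 3 dvd m \<or> \<not> 3 dvd m + 2" by presburger
  ultimately have "m = 1"
    using dvd_power_three_eq_one[of m b] dvd_power_three_eq_one[of "m + 2" b] by linarith
  with fac have "(3::nat) ^ b = 3 ^ 1" by simp
  then have "b = 1" by (subst (asm) power_inject_exp) auto
  with \<open>m = 1\<close> z show ?thesis by simp
qed

lemma sum_powers_three_eq_square:
  fixes z :: nat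
  assumes "a \<le> b" "3 ^ a + 3 ^ b = z ^ 2"
  shows "\<exists>n. a = 2 * n \<and> b = 2 * n + 1 \<and> z = 2 * 3 ^ n"
  using assms
\<comment> \<open>The descent lowers \<open>a\<close> by 2 and changes \<open>b\<close> and
  \<open>z\<close> as well.\<close>
proof (induction a arbitrary: b z rule: less_induct)
  case (less a)
  show ?case
  proof (cases "a = 0")
    case True
    then show ?thesis
      using one_plus_power_three_eq_square[of b z] less.prems by auto
  next
    case False
    with less.prems(1) have "3 dvd (3::nat) ^ a + 3 ^ b" by (simp add: dvd_power)
    then obtain w where z: "z = 3 * w"
      unfolding less.prems(2) three_dvd_square_iff by (auto elim: dvdE)
    show ?thesis
    proof (cases "a = 1")
      case True
      obtain c where b: "b = Suc c" using less.prems(1) True by (cases b) auto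
      have "1 + 3 ^ c = 3 * w ^ 2"
        using less.prems(2) by (simp add: True b z power2_eq_square)
      \<comment> \<open>For \<open>c = 0\<close> the left side is 2, not a multiple of 3. So 3
        divides \<open>3 ^ c\<close>, and hence would divide 1.\<close>
      moreover from this have "3 dvd (3::nat) ^ c"
        by (cases c) (simp, presburger, simp)
      ultimately have False by presburger
      then show ?thesis ..
    next
      case False
      with \<open>a \<noteq> 0\<close> have "2 \<le> a" by simp
      then obtain a' where a: "a = a' + 2" by (metis le_add_diff_inverse2)
      from less.prems(1) a have "2 \<le> b" by simp
      then obtain b' where b: "b = b' + 2" by (metis le_add_diff_inverse2)
      have "3 ^ a' + 3 ^ b' = w ^ 2"
        using less.prems(2) by (simp add: a b z power2_eq_square)
      then obtain n where "a' = 2 * n" "b' = 2 * n + 1" "w = 2 * 3 ^ n"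
        using less.IH[of a' b' w] less.prems(1) a b by auto
      \<comment> \<open>Undoing the division adds 2 to both exponents and multiplies the root by 3,
        which raises \<open>n\<close> by one.\<close>
      then show ?thesis by (intro exI[of _ "n + 1"]) (simp add: a b z)
    qed
  qed
qed

theorem theorem0p1:
  "{(x :: nat, y :: nat, z :: nat). 3 * 3 ^ x + 3 ^ y = z ^ 2} =
     {(2 * n, 2 * n, 2 * 3 ^ n) | n :: nat. True} \<union>
     {(1 + 2 * n, 3 + 2 * n, 2 * 3 ^ (n + 1)) | n :: nat. True}"
  (is "?S = ?A \<union> ?B")
proof (intro equalityI subsetI)
  fix t assume "t \<in> ?S"
  then obtain x y z where t: "t = (x, y, z)" and eq: "3 ^ Suc x + 3 ^ y = z ^ 2"
    by auto
  show "t \<in> ?A \<union> ?B"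
  proof (cases "Suc x \<le> y")
    case True
    then obtain n where n: "Suc x = 2 * n" "y = 2 * n + 1" "z = 2 * 3 ^ n"
      using sum_powers_three_eq_square eq by blast
    \<comment> \<open>\<open>Suc x\<close> is positive, so \<open>n > 0\<close>; the shift to
      \<open>k\<close> produces the offsets 1 and 3 of the second family.\<close>
    then obtain k where "n = Suc k" by (cases n) auto
    with n have "t = (1 + 2 * k, 3 + 2 * k, 2 * 3 ^ (k + 1))" by (simp add: t)
    then show ?thesis by blast
  next
    case False
    then obtain n where "y = 2 * n" "Suc x = 2 * n + 1" "z = 2 * 3 ^ n"
      \<comment> \<open>Now \<open>y\<close> is the smaller exponent, and
        \<open>Suc x = y + 1\<close> gives \<open>x = y\<close>.\<close>
      using sum_powers_three_eq_square[of y "Suc x" z] eq by (auto simp: add.commute)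
    then have "t = (2 * n, 2 * n, 2 * 3 ^ n)" by (simp add: t)
    then show ?thesis by blast
  qed
next
  fix t assume "t \<in> ?A \<union> ?B"
  \<comment> \<open>The left side is \<open>4 * 9 ^ n\<close> in the first family and
    \<open>4 * 9 ^ (n + 1)\<close> in the second.\<close>
  then show "t \<in> ?S"
    by (auto simp: power_even_eq power_add power2_eq_square)
qed

end
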